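(* For all integers $n\ge 0$, $$\overline{R_{4,3}}(12n+7)\equiv 0 \pmod 8 \qquad\text{and}\qquad \overline{R_{4,3}}(12n+11)\equiv 0 \pmod 8.$$
   Context: An overpartition of a nonnegative integer $n$ is a partition of $n$ (a non-increasing sequence of positive integers summing to $n$) in which the first occurrence of each part size may be overlined. For coprime positive integers $\ell,\mu$, $\overline{R_{\ell,\mu}}(n)$ denotes the number of overpartitions of $n$ in which no part is divisible by $\ell$ or by $\mu$ (with $\overline{R_{\ell,\mu}}(0)=1$). Its generating function, for $|q|<1$, is $$\sum_{n\ge 0}\overline{R_{\ell,\mu}}(n)q^n=\prod_{n=1}^{\infty}\frac{(1+q^{n})(1-q^{\ell n})(1-q^{\mu n})(1+q^{\ell\mu n})}{(1-q^{n})(1+q^{\ell n})(1+q^{\mu n})(1-q^{\ell\mu n})}.$$ The claim concerns $(\ell,\mu)=(4,3)$. *)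

theory Defs
  imports "HOL-Number_Theory.Number_Theory"
begin

text \<open>
  A part of an overpartition is a pair: its size, and a flag that is true iff
  the part is overlined.
\<close>

definition overpartition :: "nat \<Rightarrow> (nat \<times> bool) list \<Rightarrow> bool" where
  "overpartition n xs \<longleftrightarrow>
     sorted_wrt (\<ge>) (map fst xs) \<and>
     (\<forall>x\<in>set xs. 0 < fst x) \<and>
     sum_list (map fst xs) = n \<and>
     (\<forall>j<length xs. snd (xs ! j) \<longrightarrow> (\<forall>i<j. fst (xs ! i) \<noteq> fst (xs ! j)))"

definition regular_overpartitions :: "nat \<Rightarrow> nat \<Rightarrow> nat \<Rightarrow> (nat \<times> bool) list set" where
  "regular_overpartitions l m n =
     {xs. overpartition n xs \<and> (\<forall>x\<in>set xs. \<not> l dvd fst x \<and> \<not> m dvd fst x)}"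

definition R_bar :: "nat \<Rightarrow> nat \<Rightarrow> nat \<Rightarrow> nat" where
  "R_bar l m n = card (regular_overpartitions l m n)"

text \<open>The cardinality above is always that of a finite set.\<close>

lemma finite_regular_overpartitions: "finite (regular_overpartitions l m n)"
proof (rule finite_subset)
  have le: "length xs \<le> sum_list (map fst xs)"
    if "\<forall>x\<in>set xs. 0 < fst x" for xs :: "(nat \<times> bool) list"
    using that by (induction xs) fastforce+
  show "regular_overpartitions l m n
    \<subseteq> {xs. set xs \<subseteq> {..n} \<times> UNIV \<and> length xs \<le> n}"
  proof
    fix xs assume "xs \<in> regular_overpartitions l m n"
    then have pos: "\<forall>x\<in>set xs. 0 < fst x" and s: "sum_list (map fst xs) = n"
      unfolding regular_overpartitions_def overpartition_def by blast+
    have "fst x \<le> n" if "x \<in> set xs" for x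
    proof -
      have "fst x \<in> set (map fst xs)" using that by simp
      from member_le_sum_list[OF this] show ?thesis unfolding s by simp
    qed
    then have "set xs \<subseteq> {..n} \<times> UNIV" by fastforce
    moreover have "length xs \<le> n" using le[OF pos] unfolding s .
    ultimately show "xs \<in> {xs. set xs \<subseteq> {..n} \<times> UNIV \<and> length xs \<le> n}"
      by blast
  qed
  show "finite {xs. set xs \<subseteq> {..n} \<times> (UNIV :: bool set) \<and> length xs \<le> n}"
    by (rule finite_lists_length_le) simp
qed

lemma R_bar_0: "R_bar l m 0 = 1"
proof -
  have "xs = []" if "overpartition 0 xs" for xs
  proof (cases xs)
    case (Cons x ys)
    from that have "\<forall>x\<in>set xs. 0 < fst x" "sum_list (map fst xs) = 0"
      unfolding overpartition_def by blast+
    with Cons have "0 < fst x" "fst x = 0" by auto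
    then show ?thesis by simp
  qed
  moreover have "overpartition 0 []" by (simp add: overpartition_def)
  ultimately have "regular_overpartitions l m 0 = {[]}"
    unfolding regular_overpartitions_def by fastforce
  then show ?thesis by (simp add: R_bar_def)
qed

end

theory Submission
  imports Defs
begin

text \<open>
  An overpartition is a partition together with a choice of the part sizes whose first
  occurrence is overlined, so a partition with \<open>k\<close> distinct part sizes carries \<open>2 ^ k\<close>
  overpartitions.  Modulo 8 only the partitions with one or two distinct sizes survive, and
  \<open>R \<equiv> 2 * A + 4 * B\<close>, where \<open>A\<close> counts the solutions of \<open>a * x = n\<close> and \<open>B\<close> the solutions of
  \<open>a * x + b * y = n\<close> with \<open>a > b\<close>; here \<open>x, y\<close> are positive multiplicities and \<open>a, b\<close> are
  sizes divisible neither by 4 nor by 3 (\<open>R_bar_cong_8\<close>).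

  Let \<open>n \<equiv> 3\<close> modulo 4 be coprime to 3.  Then every divisor of \<open>n\<close> is an admissible size, so \<open>A\<close>
  is the number \<open>d(n)\<close> of divisors.  Dropping the condition \<open>a > b\<close>, the equation
  \<open>a * x + b * y = n\<close> has \<open>2 * B\<close> solutions with \<open>a \<noteq> b\<close>, and \<open>\<sigma>(n) - d(n)\<close> solutions with
  \<open>a = b\<close>, since then \<open>a\<close> divides \<open>n\<close> and \<open>n\<close> div \<open>a\<close> is split into two positive summands.
  Calling the total \<open>Q\<close>, this gives \<open>R \<equiv> 2 * Q + 4 * d(n) - 2 * \<sigma>(n)\<close> modulo 8.

  All three terms vanish modulo 8.  As \<open>n\<close> is odd, exactly one of \<open>a * x\<close> and \<open>b * y\<close> is even, and by
  symmetry \<open>a * x\<close> is even in exactly half of the solutions.  These are paired off by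
  \<open>(a, x) \<leftrightarrow> (2 * a, x div 2)\<close> for odd \<open>a\<close>, because an even admissible size is twice an odd
  admissible size.  Hence 4 divides \<open>Q\<close> (\<open>four_dvd_card_two_term_solutions\<close>).  Finally, in
  \<open>n = d * e\<close> with \<open>n \<equiv> 3\<close> modulo 4 one of \<open>d, e\<close> is 1 and the other 3 modulo 4, so pairing
  complementary divisors shows that \<open>d(n)\<close> is even and that 4 divides \<open>\<sigma>(n)\<close>.
\<close>

section \<open>Overpartitions as partitions with a set of overlined sizes\<close>

text \<open>
  Positivity of the parts is left to \<open>S\<close>: these are partitions when \<open>0 \<notin> S\<close>, as holds for the
  sizes that avoid the multiples of two given numbers, 0 being a multiple of both.
\<close>

definition partitions_in :: "nat set \<Rightarrow> nat \<Rightarrow> nat list set" where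
  "partitions_in S n = {ys. sorted_wrt (\<ge>) ys \<and> set ys \<subseteq> S \<and> sum_list ys = n}"

definition overlinings :: "nat list \<Rightarrow> (nat \<times> bool) list set" where
  "overlinings ys = {xs. map fst xs = ys \<and>
     (\<forall>j<length xs. snd (xs ! j) \<longrightarrow> (\<forall>i<j. fst (xs ! i) \<noteq> fst (xs ! j)))}"

text \<open>
  Appending a part to a partition offers a choice only if its size is new, because an overlined
  part must be the first one of its size.  So every distinct size contributes a factor 2.
\<close>

lemma overlinings_snoc:
  "overlinings (ys @ [a]) =
     (\<lambda>(xs, c). xs @ [(a, c)]) ` (overlinings ys \<times> (if a \<in> set ys then {False} else UNIV))"
  (is "?L = ?R")
proof (intro equalityI subsetI)
  fix zs assume "zs \<in> ?L"
  then have m: "map fst zs = ys @ [a]" and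
    o: "\<And>i j. j < length zs \<Longrightarrow> snd (zs ! j) \<Longrightarrow> i < j \<Longrightarrow> fst (zs ! i) \<noteq> fst (zs ! j)"
    unfolding overlinings_def by blast+
  from m obtain xs c where zs: "zs = xs @ [(a, c)]" and xs: "map fst xs = ys"
    by (auto simp: map_eq_append_conv)
  have "xs \<in> overlinings ys"
    unfolding overlinings_def
  proof (intro CollectI conjI allI impI xs)
    fix i j assume "j < length xs" "snd (xs ! j)" "i < j"
    with o[of j i] show "fst (xs ! i) \<noteq> fst (xs ! j)" by (simp add: zs nth_append)
  qed
  moreover have "\<not> c" if "a \<in> set ys"
  proof
    assume c
    from that xs obtain i where "i < length xs" "fst (xs ! i) = a"
      by (metis in_set_conv_nth length_map nth_map)
    with \<open>c\<close> o[of "length xs" i] show False by (simp add: zs nth_append)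
  qed
  ultimately show "zs \<in> ?R" by (auto simp: zs image_iff)
next
  fix zs assume "zs \<in> ?R"
  then obtain xs c where zs: "zs = xs @ [(a, c)]" and xs: "xs \<in> overlinings ys"
    and c: "c \<Longrightarrow> a \<notin> set ys"
    by (auto split: if_splits)
  have m: "map fst xs = ys" and
    o: "\<And>i j. j < length xs \<Longrightarrow> snd (xs ! j) \<Longrightarrow> i < j \<Longrightarrow> fst (xs ! i) \<noteq> fst (xs ! j)"
    using xs unfolding overlinings_def by blast+
  have "fst (xs ! i) \<noteq> a" if c "i < length xs" for i
    using c[OF that(1)] that(2) m by (metis length_map nth_map nth_mem)
  then show "zs \<in> ?L"
    unfolding overlinings_def using m o by (auto simp: zs nth_append less_Suc_eq)
qed

lemma card_overlinings: "finite (overlinings ys) \<and> card (overlinings ys) = 2 ^ card (set ys)"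
proof (induction ys rule: rev_induct)
  case Nil
  have "overlinings [] = {[]}" by (auto simp: overlinings_def)
  then show ?case by simp
next
  case (snoc a ys)
  have inj: "inj_on (\<lambda>(xs, c). xs @ [(a, c)]) X" for X :: "((nat \<times> bool) list \<times> bool) set"
    by (auto simp: inj_on_def)
  show ?case
    using snoc.IH
    by (auto simp: overlinings_snoc card_image[OF inj] card_cartesian_product insert_absorb)
qed

lemma finite_partitions_in:
  assumes "0 \<notin> S"
  shows "finite (partitions_in S n)"
proof (rule finite_subset)
  have "length ys \<le> sum_list ys" if "0 \<notin> set ys" for ys :: "nat list"
    using that by (induction ys) auto
  then show "partitions_in S n \<subseteq> {ys. set ys \<subseteq> {..n} \<and> length ys \<le> n}"
    using assms by (auto simp: partitions_in_def member_le_sum_list)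
qed (rule finite_lists_length_le, simp)

definition admissible_sizes :: "nat \<Rightarrow> nat \<Rightarrow> nat set" where
  "admissible_sizes l m = {a. \<not> l dvd a \<and> \<not> m dvd a}"

lemma zero_not_admissible: "0 \<notin> admissible_sizes l m"
  by (simp add: admissible_sizes_def)

lemma R_bar_eq_sum_partitions:
  "R_bar l m n = (\<Sum>ys\<in>partitions_in (admissible_sizes l m) n. 2 ^ card (set ys))"
proof -
  let ?P = "partitions_in (admissible_sizes l m) n"
  have sizes: "(\<forall>x\<in>set xs. 0 < fst x) \<and> (\<forall>x\<in>set xs. \<not> l dvd fst x \<and> \<not> m dvd fst x) \<longleftrightarrow>
      set (map fst xs) \<subseteq> admissible_sizes l m" for xs :: "(nat \<times> bool) list"
  proof -
    have "0 < a" if "\<not> l dvd a" for a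
      using that by (cases "a = 0") auto
    then show ?thesis by (auto simp: admissible_sizes_def image_subset_iff)
  qed
  have "xs \<in> regular_overpartitions l m n \<longleftrightarrow>
      map fst xs \<in> ?P \<and> xs \<in> overlinings (map fst xs)" for xs
    unfolding regular_overpartitions_def overpartition_def partitions_in_def overlinings_def
      mem_Collect_eq sizes[symmetric]
    by argo
  then have "regular_overpartitions l m n = (\<Union>ys\<in>?P. overlinings ys)"
    by (auto simp: overlinings_def)
  moreover have "card (\<Union>ys\<in>?P. overlinings ys) = (\<Sum>ys\<in>?P. card (overlinings ys))"
  proof (rule card_UN_disjoint)
    show "finite ?P" by (rule finite_partitions_in[OF zero_not_admissible])
    show "\<forall>ys\<in>?P. \<forall>zs\<in>?P. ys \<noteq> zs \<longrightarrow> overlinings ys \<inter> overlinings zs = {}"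
      by (auto simp: overlinings_def)
  qed (simp add: card_overlinings)
  ultimately show ?thesis by (simp add: R_bar_def card_overlinings)
qed

section \<open>Partitions with at most two distinct part sizes\<close>

lemma sorted_wrt_ge_replicate: "sorted_wrt (\<ge>) (replicate k (a::nat))"
  by (induction k) auto

lemma count_list_replicate: "count_list (replicate k a) b = (if a = b then k else 0)"
  by (induction k) auto

lemma sorted_two_values:
  assumes "sorted_wrt (\<ge>) ys" "set ys \<subseteq> {a, b}" "b < (a::nat)"
  shows "ys = replicate (count_list ys a) a @ replicate (count_list ys b) b"
  using assms
proof (induction ys)
  case (Cons y ys)
  show ?case
  proof (cases "y = a")
    case False
    with Cons.prems have "y = b" and "\<forall>z\<in>set ys. z \<le> b \<and> z \<in> {a, b}" by auto
    with \<open>b < a\<close> have "set ys \<subseteq> {b}" by fastforce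
    then have "ys = replicate (length ys) b" by (intro replicate_eqI) auto
    then obtain k where "ys = replicate k b" ..
    then show ?thesis using \<open>y = b\<close> \<open>b < a\<close> by (simp add: count_list_replicate)
  qed (use Cons in auto)
qed simp

lemma card_partitions_one_size:
  assumes "0 \<notin> S" "0 < n"
  shows "card {ys \<in> partitions_in S n. card (set ys) = 1} = card {a \<in> S. a dvd n}"
proof -
  have "bij_betw (\<lambda>a. replicate (n div a) a) {a \<in> S. a dvd n}
          {ys \<in> partitions_in S n. card (set ys) = 1}"
  proof (rule bij_betw_imageI)
    have ne: "n div a \<noteq> 0" if "a dvd n" for a using that \<open>0 < n\<close> by auto
    show "inj_on (\<lambda>a. replicate (n div a) a) {a \<in> S. a dvd n}"
      by (rule inj_onI) (metis (mono_tags, lifting) mem_Collect_eq ne hd_replicate)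
    show "(\<lambda>a. replicate (n div a) a) ` {a \<in> S. a dvd n} =
          {ys \<in> partitions_in S n. card (set ys) = 1}" (is "?L = ?R")
    proof (intro equalityI subsetI)
      fix ys assume "ys \<in> ?L"
      then show "ys \<in> ?R"
        using ne by (auto simp: partitions_in_def sum_list_replicate sorted_wrt_ge_replicate)
    next
      fix ys assume ys: "ys \<in> ?R"
      then obtain a where a: "set ys = {a}" by (auto simp: card_1_singleton_iff)
      have "a \<in> S" using ys a by (auto simp: partitions_in_def)
      then have "a \<noteq> 0" using \<open>0 \<notin> S\<close> by metis
      have rep: "ys = replicate (length ys) a" using a by (auto intro: replicate_eqI)
      have "n = sum_list ys" using ys by (simp add: partitions_in_def)
      also have "\<dots> = length ys * a" by (subst rep) (simp add: sum_list_replicate)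
      finally have "n = length ys * a" .
      with rep \<open>a \<in> S\<close> \<open>a \<noteq> 0\<close> show "ys \<in> ?L" by (intro image_eqI[of _ _ a]) auto
    qed
  qed
  then show ?thesis by (simp add: bij_betw_same_card)
qed

definition two_term_solutions :: "nat set \<Rightarrow> nat \<Rightarrow> ((nat \<times> nat) \<times> (nat \<times> nat)) set" where
  "two_term_solutions S n =
     {((a, x), (b, y)). a \<in> S \<and> b \<in> S \<and> 0 < x \<and> 0 < y \<and> a * x + b * y = n}"

lemma finite_two_term_solutions:
  assumes "0 \<notin> S"
  shows "finite (two_term_solutions S n)"
proof (rule finite_subset)
  show "two_term_solutions S n \<subseteq> ({..n} \<times> {..n}) \<times> ({..n} \<times> {..n})"
  proof
    fix p assume "p \<in> two_term_solutions S n"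
    then obtain a x b y where p: "p = ((a, x), (b, y))" and S: "a \<in> S" "b \<in> S"
      and pos: "0 < x" "0 < y" and n: "a * x + b * y = n"
      by (auto simp: two_term_solutions_def)
    have "0 < a" "0 < b" using S assms by (metis gr0I)+
    with pos have "a \<le> a * x" "x \<le> a * x" "b \<le> b * y" "y \<le> b * y" by simp_all
    with n have "a \<le> n" "x \<le> n" "b \<le> n" "y \<le> n" by linarith+
    then show "p \<in> ({..n} \<times> {..n}) \<times> ({..n} \<times> {..n})" by (simp add: p)
  qed
qed simp

text \<open>The condition \<open>b < a\<close> reflects that a partition lists its larger size first.\<close>

lemma card_partitions_two_sizes:
  "card {ys \<in> partitions_in S n. card (set ys) = 2} =
   card {((a, x), (b, y)) \<in> two_term_solutions S n. b < a}"
proof -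
  let ?f = "\<lambda>((a, x), (b, y)). replicate x a @ replicate y (b::nat)"
  let ?Q = "{((a, x), (b, y)) \<in> two_term_solutions S n. b < a}"
  have "bij_betw ?f ?Q {ys \<in> partitions_in S n. card (set ys) = 2}"
  proof (rule bij_betw_imageI)
    show "inj_on ?f ?Q"
    proof (rule inj_onI)
      fix p q assume pq: "p \<in> ?Q" "q \<in> ?Q" "?f p = ?f q"
      obtain a x b y a' x' b' y' where p: "p = ((a, x), (b, y))" and q: "q = ((a', x'), (b', y'))"
        by (metis prod.exhaust)
      from pq have eq: "replicate x a @ replicate y b = replicate x' a' @ replicate y' b'"
        and pos: "0 < x" "0 < y" "0 < x'" "0 < y'" and less: "b < a" "b' < a'"
        by (auto simp: p q two_term_solutions_def)
      from arg_cong[OF eq, of hd] pos have "a = a'" by (simp add: hd_append)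
      moreover from arg_cong[OF eq, of last] pos have "b = b'" by simp
      moreover have "x = x'" "y = y'"
        using arg_cong[OF eq, of "\<lambda>ys. count_list ys a"] arg_cong[OF eq, of "\<lambda>ys. count_list ys b"]
          calculation less by (auto simp: count_list_replicate)
      ultimately show "p = q" by (simp add: p q)
    qed
    show "?f ` ?Q = {ys \<in> partitions_in S n. card (set ys) = 2}" (is "?L = ?R")
    proof (intro equalityI subsetI)
      fix ys assume "ys \<in> ?L"
      then show "ys \<in> ?R"
        by (auto simp: partitions_in_def two_term_solutions_def sum_list_replicate mult.commute
            sorted_wrt_append sorted_wrt_ge_replicate)
    next
      fix ys assume ys: "ys \<in> ?R"
      then obtain u v where uv: "set ys = {u, v}" "u \<noteq> v" by (auto simp: card_2_iff)
      obtain a b where ab: "set ys = {a, b}" "b < a"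
        by (cases "v < u") (use uv in \<open>auto intro: that[of u v] that[of v u]\<close>)
      let ?x = "count_list ys a" and ?y = "count_list ys b"
      have rep: "ys = replicate ?x a @ replicate ?y b"
        using ys ab by (intro sorted_two_values) (auto simp: partitions_in_def)
      have pos: "0 < ?x" "0 < ?y" using ab by (auto simp: zero_less_iff_neq_zero count_list_0_iff)
      have "n = sum_list ys" using ys by (simp add: partitions_in_def)
      also have "\<dots> = a * ?x + b * ?y" by (subst rep) (simp add: sum_list_replicate)
      finally have "((a, ?x), (b, ?y)) \<in> ?Q"
        using pos ab ys by (auto simp: two_term_solutions_def partitions_in_def)
      then show "ys \<in> ?L" using rep by (intro image_eqI[of _ _ "((a, ?x), (b, ?y))"]) auto
    qed
  qed
  then show ?thesis by (simp add: bij_betw_same_card)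
qed

text \<open>
  A partition with \<open>k\<close> distinct sizes has weight \<open>2 ^ k\<close>, which vanishes modulo 8 for \<open>k \<ge> 3\<close>;
  the case \<open>k = 0\<close> is the empty partition, which positivity of \<open>n\<close> excludes.
\<close>

lemma R_bar_cong_8:
  fixes l m n :: nat
  assumes "0 < n"
  defines "S \<equiv> admissible_sizes l m"
  shows "[R_bar l m n = 2 * card {a \<in> S. a dvd n} +
           4 * card {((a, x), (b, y)) \<in> two_term_solutions S n. b < a}] (mod 8)"
proof -
  let ?P = "partitions_in S n"
  let ?k = "\<lambda>ys::nat list. card (set ys)"
  have S0: "0 \<notin> S" unfolding S_def by (rule zero_not_admissible)
  have fin: "finite ?P" using S0 by (rule finite_partitions_in)
  have pow: "[2 ^ ?k ys = (if ?k ys = 1 then 2 else 0) + (if ?k ys = 2 then 4 else 0)] (mod (8::nat))"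
    if "ys \<in> ?P" for ys
  proof -
    have "ys \<noteq> []" using that \<open>0 < n\<close> by (auto simp: partitions_in_def)
    then have "?k ys \<noteq> 0" by simp
    then consider "?k ys = 1" | "?k ys = 2" | "3 \<le> ?k ys" by linarith
    then show ?thesis
    proof cases
      case 3
      have "(2::nat) ^ 3 dvd 2 ^ ?k ys" using 3 by (rule le_imp_power_dvd)
      with 3 show ?thesis by (auto simp: cong_0_iff)
    qed simp_all
  qed
  have "R_bar l m n = (\<Sum>ys\<in>?P. 2 ^ ?k ys)"
    unfolding S_def by (rule R_bar_eq_sum_partitions)
  also have "[\<dots> = (\<Sum>ys\<in>?P. (if ?k ys = 1 then 2 else 0) + (if ?k ys = 2 then 4 else 0))] (mod 8)"
    using pow by (rule cong_sum)
  also have "(\<Sum>ys\<in>?P. (if ?k ys = 1 then 2 else 0) + (if ?k ys = 2 then 4 else 0)) =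
      2 * card {ys \<in> ?P. ?k ys = 1} + 4 * card {ys \<in> ?P. ?k ys = 2}"
    using fin by (simp add: sum.distrib flip: sum.inter_filter)
  finally show ?thesis
    by (simp only: card_partitions_one_size[OF S0 \<open>0 < n\<close>] card_partitions_two_sizes)
qed

section \<open>Counting the solutions of $ax + by = n$\<close>

text \<open>
  Exchanging the two terms identifies the solutions with \<open>a > b\<close> and those with \<open>a < b\<close>.  A solution
  with \<open>a = b\<close> is a divisor \<open>a\<close> together with one of the \<open>n div a - 1\<close> ways to write \<open>n div a\<close> as
  an ordered sum of two positive multiplicities.
\<close>

lemma card_two_term_solutions:
  assumes "0 \<notin> S" "0 < n"
  shows "card (two_term_solutions S n) + card {a \<in> S. a dvd n} =
    2 * card {((a, x), (b, y)) \<in> two_term_solutions S n. b < a} + (\<Sum>a | a \<in> S \<and> a dvd n. n div a)"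
proof -
  let ?Q = "two_term_solutions S n" and ?D = "{a \<in> S. a dvd n}"
  let ?G = "{((a, x), (b, y)) \<in> ?Q. b < a}" and ?L = "{((a, x), (b, y)) \<in> ?Q. a < b}"
    and ?E = "{((a, x), (b, y)) \<in> ?Q. a = b}"
  have fin: "finite ?Q" using assms(1) by (rule finite_two_term_solutions)
  have finG: "finite ?G" and finL: "finite ?L" and finE: "finite ?E"
    by (rule finite_subset[OF _ fin], blast)+
  have finD: "finite ?D" using \<open>0 < n\<close> by (intro finite_subset[OF _ finite_divisors_nat]) auto
  have "?Q = ?G \<union> (?L \<union> ?E)" by auto
  then have "card ?Q = card (?G \<union> (?L \<union> ?E))" by simp
  also have "\<dots> = card ?G + (card ?L + card ?E)"
  proof -
    have "?L \<inter> ?E = {}" "?G \<inter> (?L \<union> ?E) = {}" by auto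
    then show ?thesis using finG finL finE by (simp add: card_Un_disjoint)
  qed
  also have "card ?L = card ?G"
  proof (rule bij_betw_same_card)
    show "bij_betw prod.swap ?L ?G"
      by (rule bij_betw_byWitness[where f' = prod.swap])
        (auto simp: two_term_solutions_def add.commute)
  qed
  also have "card ?E = card (SIGMA a:?D. {1..<n div a})"
  proof (rule bij_betw_same_card)
    let ?f = "\<lambda>((a, x), (b :: nat, y :: nat)). (a :: nat, x :: nat)"
    let ?g = "\<lambda>(a, x). ((a, x), (a, n div a - x))"
    show "bij_betw ?f ?E (SIGMA a:?D. {1..<n div a})"
    proof (rule bij_betw_byWitness[where f' = ?g])
      have split: "n div a = x + y \<and> a dvd n" if "a \<in> S" "a * x + a * y = n" for a x y
      proof -
        have "0 < a" using that(1) \<open>0 \<notin> S\<close> by (metis gr0I)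
        moreover have "n = a * (x + y)" using that(2) by (simp add: distrib_left)
        ultimately show ?thesis by simp
      qed
      show "\<forall>p\<in>?E. ?g (?f p) = p"
      proof
        fix p assume "p \<in> ?E"
        then obtain a x y where "p = ((a, x), (a, y))" "a \<in> S" "a * x + a * y = n"
          by (auto simp: two_term_solutions_def)
        with split[of a x y] show "?g (?f p) = p" by simp
      qed
      show "?f ` ?E \<subseteq> (SIGMA a:?D. {1..<n div a})"
      proof
        fix q assume "q \<in> ?f ` ?E"
        then obtain a x y where "q = (a, x)" "a \<in> S" "0 < x" "0 < y" "a * x + a * y = n"
          by (auto simp: two_term_solutions_def)
        with split[of a x y] show "q \<in> (SIGMA a:?D. {1..<n div a})" by simp
      qed
      show "?g ` (SIGMA a:?D. {1..<n div a}) \<subseteq> ?E"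
        by (auto simp: two_term_solutions_def simp flip: distrib_left)
    qed simp
  qed
  also have "\<dots> = (\<Sum>a\<in>?D. n div a - 1)" using finD by simp
  finally have "card ?Q = 2 * card ?G + (\<Sum>a\<in>?D. n div a - 1)" by simp
  moreover have "(\<Sum>a\<in>?D. n div a - 1) + card ?D = (\<Sum>a\<in>?D. n div a)"
  proof -
    have "(\<Sum>a\<in>?D. n div a - 1) + card ?D = (\<Sum>a\<in>?D. n div a - 1 + 1)"
      by (subst sum.distrib) simp
    also have "\<dots> = (\<Sum>a\<in>?D. n div a)"
    proof (rule sum.cong)
      fix a assume "a \<in> ?D"
      then have "0 < n div a" using \<open>0 < n\<close> by (auto elim!: dvdE)
      then show "n div a - 1 + 1 = n div a" by simp
    qed simp
    finally show ?thesis .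
  qed
  ultimately show ?thesis by simp
qed

text \<open>
  For odd \<open>n\<close> exactly one of the two terms is even.  The two hypotheses on the sizes say that
  doubling is a bijection from the odd sizes in \<open>S\<close> to the even ones, which makes
  \<open>(a, x) \<mapsto> (2 * a, x div 2)\<close> a bijection from the even terms with odd \<open>a\<close> to those with even \<open>a\<close>.
\<close>

lemma four_dvd_card_two_term_solutions:
  assumes "odd n" "0 \<notin> S"
    and double: "\<And>a. a \<in> S \<Longrightarrow> odd a \<Longrightarrow> 2 * a \<in> S"
    and half: "\<And>a. 2 * a \<in> S \<Longrightarrow> a \<in> S \<and> odd a"
  shows "4 dvd card (two_term_solutions S n)"
proof -
  let ?Q = "two_term_solutions S n"
  let ?H = "{((a, x), (b, y)) \<in> ?Q. even (a * x)}" and ?H' = "{((a, x), (b, y)) \<in> ?Q. even (b * y)}"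
  let ?K = "{((a, x), (b, y)) \<in> ?Q. odd a \<and> even x}" and ?K' = "{((a, x), (b, y)) \<in> ?Q. even a}"
  have fin: "finite ?Q" using assms(2) by (rule finite_two_term_solutions)
  have fins: "finite ?H" "finite ?H'" "finite ?K" "finite ?K'"
    by (rule finite_subset[OF _ fin], blast)+
  have par: "even (a * x) \<longleftrightarrow> odd (b * y)" if "((a, x), (b, y)) \<in> ?Q" for a x b y
  proof -
    have "a * x + b * y = n" using that by (simp add: two_term_solutions_def)
    with \<open>odd n\<close> show ?thesis by (metis even_add)
  qed
  have "?Q = ?H \<union> ?H'" and "?H \<inter> ?H' = {}" using par by blast+
  then have "card ?Q = card ?H + card ?H'"
    using fins by (metis (no_types, lifting) card_Un_disjoint)
  also have "card ?H' = card ?H"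
  proof (rule bij_betw_same_card)
    show "bij_betw prod.swap ?H' ?H"
      by (rule bij_betw_byWitness[where f' = prod.swap])
        (auto simp: two_term_solutions_def add.commute)
  qed
  finally have Q: "card ?Q = 2 * card ?H" by (simp only: mult_2)
  have "?H = ?K \<union> ?K'" and "?K \<inter> ?K' = {}" by auto
  then have "card ?H = card ?K + card ?K'"
    using fins by (metis (no_types, lifting) card_Un_disjoint)
  also have "card ?K = card ?K'"
  proof (rule bij_betw_same_card)
    show "bij_betw (\<lambda>((a, x), q). ((2 * a, x div 2), q)) ?K ?K'"
      by (rule bij_betw_byWitness[where f' = "\<lambda>((a, x), q). ((a div 2, 2 * x), q)"])
        (auto simp: two_term_solutions_def double dest: half elim!: evenE)
  qed
  finally have "card ?Q = 4 * card ?K'" using Q by linarith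
  then show ?thesis by (rule dvdI)
qed

section \<open>Divisors of numbers congruent to 3 modulo 4\<close>

text \<open>
  If \<open>d * e = n \<equiv> 3\<close> modulo 4, then \<open>d\<close> and \<open>e\<close> are 1 and 3 modulo 4 in some order.  So
  complementation exchanges the divisors congruent to 1 with those congruent to 3, and each pair
  of complementary divisors has a sum divisible by 4.
\<close>

lemma divisors_of_3_mod_4:
  fixes n :: nat
  assumes "n mod 4 = 3"
  shows "even (card {d. d dvd n})" and "4 dvd (\<Sum>d | d dvd n. n div d)"
proof -
  let ?D = "\<lambda>r. {d. d dvd n \<and> d mod 4 = r}"
  have n: "0 < n" using assms by (cases n) auto
  have fin: "finite (?D r)" for r using n by (intro finite_subset[OF _ finite_divisors_nat]) auto
  have compl: "d mod 4 = 1 \<and> e mod 4 = 3 \<or> d mod 4 = 3 \<and> e mod 4 = 1" if "n = d * e" for d e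
  proof -
    have "d mod 4 * (e mod 4) mod 4 = 3" using that assms by (simp add: mod_mult_eq)
    moreover have "d mod 4 \<in> {0, 1, 2, 3}" "e mod 4 \<in> {0, 1, 2, 3}" by auto
    ultimately show ?thesis by auto
  qed
  have div: "n = d * (n div d)" if "d dvd n" for d using that by simp
  have D: "{d. d dvd n} = ?D 1 \<union> ?D 3" using compl[OF div] by blast
  have disj: "?D 1 \<inter> ?D 3 = {}" by auto
  have bij: "bij_betw (\<lambda>d. n div d) (?D 1) (?D 3)"
  proof (rule bij_betw_byWitness[where f' = "\<lambda>d. n div d"])
    have "n div d dvd n" if "d dvd n" for d using that by (metis div dvd_triv_right)
    then show "(\<lambda>d. n div d) ` ?D 1 \<subseteq> ?D 3" "(\<lambda>d. n div d) ` ?D 3 \<subseteq> ?D 1"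
      using compl[OF div] by force+
  qed (use n in \<open>auto elim!: dvdE\<close>)
  have "card {d. d dvd n} = card (?D 1) + card (?D 3)"
    unfolding D by (intro card_Un_disjoint fin disj)
  then show "even (card {d. d dvd n})" using bij_betw_same_card[OF bij] by simp
  have "(\<Sum>d | d dvd n. n div d) = (\<Sum>d\<in>?D 1. n div d) + (\<Sum>d\<in>?D 3. n div d)"
    unfolding D by (intro sum.union_disjoint fin disj)
  also have "(\<Sum>d\<in>?D 3. n div d) = (\<Sum>d\<in>?D 1. n div (n div d))"
    by (rule sum.reindex_bij_betw[OF bij, symmetric])
  also have "\<dots> = (\<Sum>d\<in>?D 1. d)"
    using n by (intro sum.cong) (auto elim!: dvdE)
  finally have "(\<Sum>d | d dvd n. n div d) = (\<Sum>d\<in>?D 1. n div d + d)"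
    by (simp add: sum.distrib)
  moreover have "4 dvd n div d + d" if "d \<in> ?D 1" for d
  proof -
    have "d mod 4 = 1" "n div d mod 4 = 3" using that compl[OF div[of d]] by auto
    then have "(n div d + d) mod 4 = (3 + 1) mod 4" by (intro mod_add_cong) simp_all
    then show ?thesis by auto
  qed
  ultimately show "4 dvd (\<Sum>d | d dvd n. n div d)" by (metis (no_types, lifting) dvd_sum)
qed

section \<open>The congruence modulo 8\<close>

lemma eight_dvd_R_bar_4_3:
  assumes "n mod 4 = 3" "\<not> 3 dvd n"
  shows "8 dvd R_bar 4 3 n"
proof -
  define S where "S = admissible_sizes 4 3"
  define A where "A = card {a \<in> S. a dvd n}"
  define B where "B = card {((a, x), (b, y)) \<in> two_term_solutions S n. b < a}"
  have n: "odd n" "0 < n" using assms(1) by presburger+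
  have S0: "0 \<notin> S" unfolding S_def by (rule zero_not_admissible)
  have "\<not> 4 dvd a" "\<not> 3 dvd a" if "a dvd n" for a
    using that n(1) assms(2) by (auto elim!: dvdE)
  then have "a \<in> S" if "a dvd n" for a
    using that by (simp add: S_def admissible_sizes_def)
  then have D: "{a \<in> S. a dvd n} = {d. d dvd n}" by blast
  have "4 dvd card (two_term_solutions S n)"
    using n(1) S0
  proof (rule four_dvd_card_two_term_solutions)
    show "2 * a \<in> S" if "a \<in> S" "odd a" for a
      using that unfolding S_def admissible_sizes_def mem_Collect_eq by presburger
    show "a \<in> S \<and> odd a" if "2 * a \<in> S" for a
      using that unfolding S_def admissible_sizes_def mem_Collect_eq by presburger
  qed
  then obtain k where k: "card (two_term_solutions S n) = 4 * k" ..
  obtain s where s: "(\<Sum>d | d dvd n. n div d) = 4 * s"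
    using divisors_of_3_mod_4(2)[OF assms(1)] ..
  obtain t where t: "A = 2 * t"
    using divisors_of_3_mod_4(1)[OF assms(1)] unfolding A_def D ..
  have "4 * k + A = 2 * B + 4 * s"
    using card_two_term_solutions[OF S0 n(2)] unfolding A_def B_def k by (simp only: D s)
  with t have "8 dvd 2 * A + 4 * B" by presburger
  moreover have "[R_bar 4 3 n = 2 * A + 4 * B] (mod 8)"
    unfolding A_def B_def S_def using n(2) by (rule R_bar_cong_8)
  ultimately show ?thesis by (simp add: cong_dvd_iff)
qed

theorem theorem4p1:
  fixes n :: nat
  shows "[R_bar 4 3 (12 * n + 7) = 0] (mod 8) \<and> [R_bar 4 3 (12 * n + 11) = 0] (mod 8)"
proof -
  have "(12 * n + 7) mod 4 = 3" "\<not> 3 dvd 12 * n + 7"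
    and "(12 * n + 11) mod 4 = 3" "\<not> 3 dvd 12 * n + 11"
    by presburger+
  then show ?thesis unfolding cong_0_iff by (blast intro: eight_dvd_R_bar_4_3)
qed

end
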